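(* Let $m\ge 3$ be an odd integer, let $1\le i<m$ with $\gcd(i,m)=1$, and put $q=2^i$. Let $c_1,\dots,c_8\in\mathbb{F}_{2^m}$ with $c_1,c_4,c_5,c_8\neq 0$, and let $G:\mathbb{F}_{2^m}^3\to\mathbb{F}_{2^m}^3$ be the function $$G(x,y,z)=\big(c_1x^{q+1}+c_2x^qz+c_3yz^q,\ \ c_4x^qz+c_5y^{q+1},\ \ c_6xy^q+c_7y^qz+c_8z^{q+1}\big).$$ Then $G$ is affine equivalent to a function of the form $$G_{\mathrm{norm}}(x,y,z)=\big(x^{q+1}+a_1x^qz+a_2yz^q,\ \ x^qz+y^{q+1},\ \ a_3xy^q+a_4y^qz+z^{q+1}\big)$$ for some parameters $a_1,a_2,a_3,a_4\in\mathbb{F}_{2^m}$.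
   Context: Two functions $F,F':\mathbb{F}_{2^m}^3\to\mathbb{F}_{2^m}^3$ are affine equivalent if $F'=A_1\circ F\circ A_2$ for some affine bijections $A_1,A_2$ of $\mathbb{F}_{2^m}^3$. *)

theory Defs
  imports "HOL-Analysis.Analysis"
begin

text \<open>
  The field with \<open>2 ^ m\<close> elements is a type \<open>'a :: {field, finite}\<close> with \<open>CARD('a) = 2 ^ m\<close>,
  and \<open>'a ^ 3\<close> is its three-dimensional coordinate space.
\<close>

text \<open>
  Affine is meant over the scalar field \<open>'a\<close> itself. This implies affinity over the prime
  field, the reading common for vectorial Boolean functions: see \<open>affine_map_additive\<close>.
\<close>

definition affine_map :: "('a::field ^ 'n \<Rightarrow> 'a ^ 'n) \<Rightarrow> bool" where
  "affine_map A \<longleftrightarrow> (\<exists>L b. Vector_Spaces.linear (*s) (*s) L \<and> A = (\<lambda>v. L v + b))"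

definition affine_bijection :: "('a::field ^ 'n \<Rightarrow> 'a ^ 'n) \<Rightarrow> bool" where
  "affine_bijection A \<longleftrightarrow> affine_map A \<and> bij A"

definition affine_equivalent ::
    "('a::field ^ 'n \<Rightarrow> 'a ^ 'n) \<Rightarrow> ('a ^ 'n \<Rightarrow> 'a ^ 'n) \<Rightarrow> bool" where
  "affine_equivalent F F' \<longleftrightarrow>
    (\<exists>A\<^sub>1 A\<^sub>2. affine_bijection A\<^sub>1 \<and> affine_bijection A\<^sub>2 \<and> F' = A\<^sub>1 \<circ> F \<circ> A\<^sub>2)"

lemma affine_map_additive:
  assumes "affine_map A"
  shows "\<exists>L b. (\<forall>u v. L (u + v) = L u + L v) \<and> A = (\<lambda>v. L v + b)"
  using assms unfolding affine_map_def
  by (metis Vector_Spaces.linear.axioms(3) module_hom.add)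

definition trivariate_G ::
    "nat \<Rightarrow> 'a::field \<Rightarrow> 'a \<Rightarrow> 'a \<Rightarrow> 'a \<Rightarrow> 'a \<Rightarrow> 'a \<Rightarrow> 'a \<Rightarrow> 'a \<Rightarrow> 'a ^ 3 \<Rightarrow> 'a ^ 3" where
  "trivariate_G q c\<^sub>1 c\<^sub>2 c\<^sub>3 c\<^sub>4 c\<^sub>5 c\<^sub>6 c\<^sub>7 c\<^sub>8 v =
    (let x = v $ 1; y = v $ 2; z = v $ 3 in
      vector [c\<^sub>1 * x ^ (q + 1) + c\<^sub>2 * x ^ q * z + c\<^sub>3 * y * z ^ q,
              c\<^sub>4 * x ^ q * z + c\<^sub>5 * y ^ (q + 1),
              c\<^sub>6 * x * y ^ q + c\<^sub>7 * y ^ q * z + c\<^sub>8 * z ^ (q + 1)])"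

definition trivariate_G_norm ::
    "nat \<Rightarrow> 'a::field \<Rightarrow> 'a \<Rightarrow> 'a \<Rightarrow> 'a \<Rightarrow> 'a ^ 3 \<Rightarrow> 'a ^ 3" where
  "trivariate_G_norm q a\<^sub>1 a\<^sub>2 a\<^sub>3 a\<^sub>4 v =
    (let x = v $ 1; y = v $ 2; z = v $ 3 in
      vector [x ^ (q + 1) + a\<^sub>1 * x ^ q * z + a\<^sub>2 * y * z ^ q,
              x ^ q * z + y ^ (q + 1),
              a\<^sub>3 * x * y ^ q + a\<^sub>4 * y ^ q * z + z ^ (q + 1)])"

end

theory Submission
  imports Defs
begin

text \<open>
  A rescaling of the coordinates, before and after \<open>G\<close>, multiplies each monomial of \<open>G\<close> by a
  nonzero constant, so it suffices to choose the scaling factors such that \<open>x\<^sup>q\<^sup>+\<^sup>1\<close>, \<open>x\<^sup>qz\<close>,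
  \<open>y\<^sup>q\<^sup>+\<^sup>1\<close> and \<open>z\<^sup>q\<^sup>+\<^sup>1\<close> get coefficient 1.

  The second component is the only one in which two coefficients must become 1 at the same time,
  which needs their quotient to be corrected before \<open>G\<close> is applied. Since \<open>x\<^sup>qz\<close> is linear in
  \<open>z\<close>, the substitution \<open>z \<mapsto> (c\<^sub>5 / c\<^sub>4) z\<close> alone achieves this: it makes both coefficients
  equal to \<open>c\<^sub>5\<close>, and no root has to be extracted. Each output coordinate is then divided by its
  remaining leading coefficient: \<open>c\<^sub>1\<close> for the first, \<open>c\<^sub>5\<close> for the second, and
  \<open>c\<^sub>8 (c\<^sub>5 / c\<^sub>4)\<^sup>q\<^sup>+\<^sup>1\<close> for the third. The parameters \<open>a\<^sub>1, \<dots>, a\<^sub>4\<close> are what the other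
  coefficients become.
\<close>

lemma affine_bijection_diagonal:
  fixes d :: "'n::finite \<Rightarrow> 'a::field"
  assumes "\<And>j. d j \<noteq> 0"
  shows "affine_bijection (\<lambda>v. \<chi> j. d j * v $ j)"
proof -
  let ?D = "\<lambda>v :: 'a ^ 'n. \<chi> j. d j * v $ j"
  have "Vector_Spaces.linear (*s) (*s) ?D"
    by unfold_locales (simp_all add: vec_eq_iff algebra_simps)
  moreover have "?D = (\<lambda>v. ?D v + 0)"
    by simp
  ultimately have "affine_map ?D"
    unfolding affine_map_def by blast
  moreover have "bij ?D"
    by (rule o_bij[where g = "\<lambda>v. \<chi> j. v $ j / d j"])
      (simp_all add: assms fun_eq_iff vec_eq_iff)
  ultimately show ?thesis
    by (simp add: affine_bijection_def)
qed

lemma affine_bijection_diagonal_3: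
  fixes a b c :: "'a::field"
  assumes "a \<noteq> 0" "b \<noteq> 0" "c \<noteq> 0"
  shows "affine_bijection (\<lambda>v :: 'a ^ 3. vector [a * v $ 1, b * v $ 2, c * v $ 3])"
proof -
  let ?d = "vector [a, b, c] :: 'a ^ 3"
  have "?d $ j \<noteq> 0" for j
    using exhaust_3[of j] assms by auto
  moreover have "(\<chi> j. ?d $ j * v $ j) = vector [a * v $ 1, b * v $ 2, c * v $ 3]" for v
    by (simp add: vec_eq_iff forall_3)
  ultimately show ?thesis
    using affine_bijection_diagonal[of "\<lambda>j. ?d $ j"] by simp
qed

theorem proposition3p1:
  fixes m i q :: nat
    and c\<^sub>1 c\<^sub>2 c\<^sub>3 c\<^sub>4 c\<^sub>5 c\<^sub>6 c\<^sub>7 c\<^sub>8 :: "'a::{field, finite}"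
  assumes "CARD('a) = 2 ^ m"
    and "m \<ge> 3" and "odd m"
    and "1 \<le> i" and "i < m" and "gcd i m = 1"
    and "q = 2 ^ i"
    and "c\<^sub>1 \<noteq> 0" and "c\<^sub>4 \<noteq> 0" and "c\<^sub>5 \<noteq> 0" and "c\<^sub>8 \<noteq> 0"
  shows "\<exists>a\<^sub>1 a\<^sub>2 a\<^sub>3 a\<^sub>4.
    affine_equivalent (trivariate_G q c\<^sub>1 c\<^sub>2 c\<^sub>3 c\<^sub>4 c\<^sub>5 c\<^sub>6 c\<^sub>7 c\<^sub>8)
                      (trivariate_G_norm q a\<^sub>1 a\<^sub>2 a\<^sub>3 a\<^sub>4)"
proof -
  define g where "g = c\<^sub>5 / c\<^sub>4"
  define k where "k = c\<^sub>8 * g ^ (q + 1)"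
  have g: "g \<noteq> 0" and c4: "c\<^sub>4 * g = c\<^sub>5"
    using assms by (auto simp: g_def)
  have k: "k \<noteq> 0"
    using g assms by (simp add: k_def)
  let ?A\<^sub>1 = "\<lambda>v :: 'a ^ 3. vector [(1 / c\<^sub>1) * v $ 1, (1 / c\<^sub>5) * v $ 2, (1 / k) * v $ 3] :: 'a ^ 3"
  let ?A\<^sub>2 = "\<lambda>v :: 'a ^ 3. vector [1 * v $ 1, 1 * v $ 2, g * v $ 3] :: 'a ^ 3"
  let ?G = "trivariate_G q c\<^sub>1 c\<^sub>2 c\<^sub>3 c\<^sub>4 c\<^sub>5 c\<^sub>6 c\<^sub>7 c\<^sub>8"
  let ?N = "trivariate_G_norm q (c\<^sub>2 * g / c\<^sub>1) (c\<^sub>3 * g ^ q / c\<^sub>1) (c\<^sub>6 / k) (c\<^sub>7 * g / k)"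
  have bij: "affine_bijection ?A\<^sub>1" "affine_bijection ?A\<^sub>2"
    using g k assms by (intro affine_bijection_diagonal_3; simp)+
  have "?N v = ?A\<^sub>1 (?G (?A\<^sub>2 v))" for v
  proof -
    define x y z where "x = v $ 1" and "y = v $ 2" and "z = v $ 3"
    have first: "x ^ (q + 1) + c\<^sub>2 * g / c\<^sub>1 * x ^ q * z + c\<^sub>3 * g ^ q / c\<^sub>1 * y * z ^ q =
        (1 / c\<^sub>1) * (c\<^sub>1 * x ^ (q + 1) + c\<^sub>2 * x ^ q * (g * z) + c\<^sub>3 * y * (g * z) ^ q)"
      using assms by (simp add: field_simps power_mult_distrib)
    have "c\<^sub>4 * x ^ q * (g * z) + c\<^sub>5 * y ^ (q + 1) = c\<^sub>5 * (x ^ q * z + y ^ (q + 1))"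
      unfolding c4[symmetric] by (simp add: algebra_simps)
    then have second: "x ^ q * z + y ^ (q + 1) =
        (1 / c\<^sub>5) * (c\<^sub>4 * x ^ q * (g * z) + c\<^sub>5 * y ^ (q + 1))"
      using assms by simp
    have c8: "c\<^sub>8 * (g * z) ^ (q + 1) = k * z ^ (q + 1)"
      unfolding k_def power_mult_distrib by simp
    have third: "c\<^sub>6 / k * x * y ^ q + c\<^sub>7 * g / k * y ^ q * z + z ^ (q + 1) =
        (1 / k) * (c\<^sub>6 * x * y ^ q + c\<^sub>7 * y ^ q * (g * z) + c\<^sub>8 * (g * z) ^ (q + 1))"
      unfolding c8 using k by (simp add: field_simps)
    show ?thesis
      using first second third
      unfolding trivariate_G_def trivariate_G_norm_def Let_def x_def y_def z_def vector_3 mult_1_left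
      by simp
  qed
  then have "?N = ?A\<^sub>1 \<circ> ?G \<circ> ?A\<^sub>2"
    by (simp add: fun_eq_iff)
  with bij show ?thesis
    unfolding affine_equivalent_def by blast
qed

end
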